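(* Let $l\ge 2$ and $\kappa_l\ge 1$ be integers and $n\ge \kappa_l+l$. Let $\mathcal{D}_{n,\kappa_l}$ be the set of strongly connected digraphs of order $n$ with $l$-connectivity $\kappa_l$. Let $\overrightarrow{G}^{\kappa_l}_{n}=\overrightarrow{G}^{\kappa_l}_{n_1,n_2,\ldots,n_l}$ where exactly one of $n_1,\ldots,n_l$ equals $n-\kappa_l-l+1$ and all the others equal $1$. Then $\overrightarrow{G}^{\kappa_l}_{n}$ maximizes the spectral radius among all digraphs in $\mathcal{D}_{n,\kappa_l}$.
   Context: Digraphs have no loops or multiple arcs; an arc $uv$ has initial vertex $u$ and terminal vertex $v$, and the adjacency matrix $A(D)$ has $(u,v)$ entry $1$ iff $uv$ is an arc. The spectral radius $\rho(D)$ is the largest modulus of an eigenvalue of $A(D)$. $D$ is strongly connected if for every pair of vertices $x,y$ there are directed paths from $x$ to $y$ and from $y$ to $x$. The $l$-connectivity of a strongly connected digraph is the minimum number of vertices whose removal produces a digraph with at least $l$ strongly connected components or a digraph with fewer than $l$ vertices. $\overrightarrow{K}_m$ is the complete digraph on $m$ vertices (both arcs $uv$ and $vu$ for each pair of distinct vertices). For disjoint digraphs $D_1,D_2$, $D_1\nabla D_2$ is the digraph on $V(D_1)\cup V(D_2)$ with arc set $E(D_1)\cup E(D_2)\cup\{uv,vu : u\in V(D_1), v\in V(D_2)\}$. For positive integers $k,n_1,\ldots,n_l$, $\overrightarrow{G}^{k}_{n_1,\ldots,n_l}$ is the digraph $\overrightarrow{K}_{k}\nabla (\overrightarrow{K}_{n_1}\cup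 \cdots \cup \overrightarrow{K}_{n_l})$ together with the additional arc set $F=\{vu : v\in V(\overrightarrow{K}_{n_i}),\ u\in V(\overrightarrow{K}_{n_j}),\ 1\le i<j\le l\}$. *)

theory Defs
  imports "Graph_Theory.Graph_Theory" "Jordan_Normal_Form.Spectral_Radius"
begin

text \<open>
  Digraphs are finite and loopless without parallel arcs: \<^locale>\<open>pair_digraph\<close>. An arc with
  initial vertex \<open>u\<close> and terminal vertex \<open>v\<close> is the pair \<open>(u, v)\<close>.
\<close>

section \<open>Spectral radius\<close>

definition adjacency_mat :: "'a pair_pre_digraph \<Rightarrow> 'a list \<Rightarrow> complex mat" where
  "adjacency_mat D vs =
     mat (length vs) (length vs) (\<lambda>(i, j). if (vs ! i, vs ! j) \<in> parcs D then 1 else 0)"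

text \<open>
  Matrices of the library are indexed by numbers, so the vertices have to be listed in some
  order; the choice is immaterial, see \<open>digraph_spectral_radius_eq\<close> below.
\<close>
definition digraph_spectral_radius :: "'a pair_pre_digraph \<Rightarrow> real" where
  "digraph_spectral_radius D =
     spectral_radius (adjacency_mat D (SOME vs. distinct vs \<and> set vs = pverts D))"

lemma eigenvalue_adjacency_mat_mono:
  assumes vs: "distinct vs" "set vs = V" and ws: "distinct ws" "set ws = V"
    and ev: "eigenvalue (adjacency_mat D vs) c"
  shows "eigenvalue (adjacency_mat D ws) c"
proof -
  define n where "n = length vs"
  have n: "length vs = n" "length ws = n"
    using vs ws by (auto simp: n_def dest!: distinct_card)
  have bv: "bij_betw ((!) vs) {..<n} V" and bw: "bij_betw ((!) ws) {..<n} V"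
    using bij_betw_nth[OF vs(1)] bij_betw_nth[OF ws(1)] vs ws n by auto
  define p where "p = (\<lambda>i. inv_into {..<n} ((!) vs) (ws ! i))"
  have bp: "bij_betw p {..<n} {..<n}"
    using bij_betw_trans[OF bw bij_betw_inv_into[OF bv]] by (simp add: p_def comp_def)
  have p: "vs ! p i = ws ! i" "p i < n" if "i < n" for i
    using that bij_betw_inv_into_right[OF bv] bij_betwE[OF bw] bij_betwE[OF bp]
    by (auto simp: p_def)
  let ?A = "adjacency_mat D vs" and ?B = "adjacency_mat D ws"
  have A: "?A \<in> carrier_mat n n" and B: "?B \<in> carrier_mat n n"
    by (auto simp: adjacency_mat_def n)
  from ev obtain x where x: "x \<in> carrier_vec n" "x \<noteq> 0\<^sub>v n" "?A *\<^sub>v x = c \<cdot>\<^sub>v x"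
    using A by (auto simp: eigenvalue_def eigenvector_def)
  define y where "y = vec n (\<lambda>i. x $ p i)"
  have y: "y \<in> carrier_vec n" by (simp add: y_def)
  obtain i where i: "i < n" "x $ i \<noteq> 0"
    using x(1,2) by (metis carrier_vecD eq_vecI index_zero_vec(1) index_zero_vec(2))
  obtain j where j: "j < n" "p j = i"
    using bp i(1) by (metis bij_betw_iff_bijections lessThan_iff)
  have "y $ j \<noteq> 0" using i j by (simp add: y_def)
  hence "y \<noteq> 0\<^sub>v n" using j by auto
  moreover have "?B *\<^sub>v y = c \<cdot>\<^sub>v y"
  proof (rule eq_vecI)
    fix i assume "i < dim_vec (c \<cdot>\<^sub>v y)"
    hence i: "i < n" by (simp add: y_def)
    have "(?B *\<^sub>v y) $ i = (\<Sum>j\<in>{..<n}. ?A $$ (p i, p j) * x $ p j)"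
      using i B p
      by (auto simp: scalar_prod_def y_def adjacency_mat_def n atLeast0LessThan intro!: sum.cong)
    also have "\<dots> = (\<Sum>j\<in>{..<n}. ?A $$ (p i, j) * x $ j)"
      by (rule sum.reindex_bij_betw[OF bp])
    also have "\<dots> = (?A *\<^sub>v x) $ p i"
      using i x(1) A p
      by (auto simp: scalar_prod_def adjacency_mat_def n atLeast0LessThan intro!: sum.cong)
    also have "\<dots> = (c \<cdot>\<^sub>v y) $ i"
      using i x p by (auto simp: y_def)
    finally show "(?B *\<^sub>v y) $ i = (c \<cdot>\<^sub>v y) $ i" .
  qed (use B in \<open>auto simp: y_def\<close>)
  ultimately show ?thesis
    using y B by (auto simp: eigenvalue_def eigenvector_def)
qed

lemma digraph_spectral_radius_eq:
  assumes "distinct vs" "set vs = pverts D"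
  shows "digraph_spectral_radius D = spectral_radius (adjacency_mat D vs)"
proof -
  let ?ws = "SOME vs. distinct vs \<and> set vs = pverts D"
  have ws: "distinct ?ws \<and> set ?ws = pverts D"
    by (rule someI[of "\<lambda>vs. distinct vs \<and> set vs = pverts D" vs]) (use assms in simp)
  have "eigenvalue (adjacency_mat D ?ws) = eigenvalue (adjacency_mat D vs)"
    using ws assms by (blast intro: eigenvalue_adjacency_mat_mono)
  thus ?thesis
    by (simp add: digraph_spectral_radius_def spectral_radius_def spectrum_def)
qed

section \<open>Generalized connectivity\<close>

text \<open>
  The set \<open>S\<close> of removed vertices may be empty, and it may be all of \<open>pverts D\<close>; the latter
  makes the minimum well defined for every \<open>l \<ge> 1\<close>.
\<close>
definition l_connectivity :: "nat \<Rightarrow> 'a pair_pre_digraph \<Rightarrow> nat" where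
  "l_connectivity l D = (LEAST m. \<exists>S \<subseteq> pverts D. card S = m \<and>
     (card (pre_digraph.sccs (with_proj D \<restriction> (pverts D - S))) \<ge> l \<or> card (pverts D - S) < l))"

definition digraphs_of_l_connectivity :: "nat \<Rightarrow> nat \<Rightarrow> nat \<Rightarrow> 'a pair_pre_digraph set" where
  "digraphs_of_l_connectivity l n \<kappa> =
     {D. pair_digraph D \<and> strongly_connected (with_proj D) \<and> card (pverts D) = n \<and>
         l_connectivity l D = \<kappa>}"

section \<open>The digraphs \<open>G\<^sup>k\<close> with parameters \<open>n\<^sub>1, \<dots>, n\<^sub>l\<close>\<close>

definition complete_on :: "'a set \<Rightarrow> 'a pair_pre_digraph" where
  "complete_on V = \<lparr>pverts = V, parcs = {(u, v). u \<in> V \<and> v \<in> V \<and> u \<noteq> v}\<rparr>"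

definition digraph_UN :: "'i set \<Rightarrow> ('i \<Rightarrow> 'a pair_pre_digraph) \<Rightarrow> 'a pair_pre_digraph" where
  "digraph_UN I D = \<lparr>pverts = (\<Union>i\<in>I. pverts (D i)), parcs = (\<Union>i\<in>I. parcs (D i))\<rparr>"

text \<open>Only meaningful for digraphs with disjoint vertex sets.\<close>
definition digraph_join ::
    "'a pair_pre_digraph \<Rightarrow> 'a pair_pre_digraph \<Rightarrow> 'a pair_pre_digraph" (infixl \<open>\<nabla>\<close> 65) where
  "D\<^sub>1 \<nabla> D\<^sub>2 = \<lparr>pverts = pverts D\<^sub>1 \<union> pverts D\<^sub>2,
     parcs = parcs D\<^sub>1 \<union> parcs D\<^sub>2 \<union> pverts D\<^sub>1 \<times> pverts D\<^sub>2 \<union> pverts D\<^sub>2 \<times> pverts D\<^sub>1\<rparr>"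

text \<open>
  Disjoint vertex sets for the complete digraphs: block \<open>0\<close> carries the complete digraph on \<open>k\<close>
  vertices, and block \<open>i\<close>, for \<open>1 \<le> i \<le> l\<close>, the one on \<open>ns i\<close> vertices. Values of \<open>ns\<close> outside
  \<open>{1..l}\<close> are irrelevant.
\<close>
definition block :: "nat \<Rightarrow> nat \<Rightarrow> (nat \<times> nat) set" where
  "block i m = {i} \<times> {..<m}"

definition G_digraph :: "nat \<Rightarrow> nat \<Rightarrow> (nat \<Rightarrow> nat) \<Rightarrow> (nat \<times> nat) pair_pre_digraph" where
  "G_digraph k l ns =
     (let H = complete_on (block 0 k) \<nabla> digraph_UN {1..l} (\<lambda>i. complete_on (block i (ns i)));
          F = {(v, u). \<exists>i j. 1 \<le> i \<and> i < j \<and> j \<le> l \<and> v \<in> block i (ns i) \<and> u \<in> block j (ns j)}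
      in \<lparr>pverts = pverts H, parcs = parcs H \<union> F\<rparr>)"

end

theory Submission
  imports Defs
begin

text \<open>
  Deleting a minimum separating set \<open>S\<close> from \<open>D\<close> leaves at least \<open>l\<close> strong components. A
  topological order of them, with the surplus ones merged, splits the remaining vertices into \<open>l\<close>
  nonempty layers of sizes \<open>c 1, \<dots>, c l\<close> such that no arc goes back to an earlier layer; so \<open>D\<close> is
  a subdigraph of \<open>G\<^sup>\<kappa>\<close> with parameters \<open>c 1, \<dots>, c l\<close>.

  Eliminating the layers one by one from the eigenvalue equation of that digraph for the value
  \<open>t - 1\<close> leaves \<open>\<kappa> t\<^sup>l = t (t - c 1) \<cdots> (t - c l)\<close>, which does not depend on the order of the
  layers. Take for \<open>t\<close> the root belonging to the extremal sizes. By the Weierstrass product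
  inequality the right-hand side is only larger for any other sizes with the same sum, so the
  positive weights \<open>x\<close> found by the elimination satisfy \<open>A(D) x \<le> (t - 1) x\<close>, with equality for
  the extremal digraph. This bounds the spectral radius of \<open>D\<close> by \<open>t - 1\<close>, which is an eigenvalue
  of the extremal digraph.
\<close>

section \<open>Spectral radius and vertex weights\<close>

lemma adjacency_mat_mult_vec:
  assumes "distinct vs" "set vs = pverts D" "i < length vs"
  shows "(adjacency_mat D vs *\<^sub>v vec (length vs) (\<lambda>j. y (vs ! j))) $ i =
    (\<Sum>v | v \<in> pverts D \<and> (vs ! i, v) \<in> parcs D. y v)"
proof -
  have bij: "bij_betw ((!) vs) {..<length vs} (pverts D)"
    using assms bij_betw_nth by blast
  have "(adjacency_mat D vs *\<^sub>v vec (length vs) (\<lambda>j. y (vs ! j))) $ i =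
      (\<Sum>j<length vs. if (vs ! i, vs ! j) \<in> parcs D then y (vs ! j) else 0)"
    using assms(3)
    by (auto simp: scalar_prod_def adjacency_mat_def atLeast0LessThan intro!: sum.cong)
  also have "\<dots> = (\<Sum>v\<in>pverts D. if (vs ! i, v) \<in> parcs D then y v else 0)"
    by (rule sum.reindex_bij_betw[OF bij])
  also have "\<dots> = (\<Sum>v | v \<in> pverts D \<and> (vs ! i, v) \<in> parcs D. y v)"
    using assms(2)[symmetric] by (simp add: sum.inter_filter)
  finally show ?thesis .
qed

text \<open>Lets eigenvectors be treated as functions on vertices, so that the listing
  \<open>vs\<close> drops out of the estimates.\<close>

lemma eigenvalue_adjacency_mat_iff:
  assumes vs: "distinct vs" "set vs = pverts D"
  shows "eigenvalue (adjacency_mat D vs) c \<longleftrightarrow>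
    (\<exists>y. (\<exists>u\<in>pverts D. y u \<noteq> 0) \<and>
      (\<forall>u\<in>pverts D. (\<Sum>v | v \<in> pverts D \<and> (u, v) \<in> parcs D. y v) = c * y u))"
proof -
  define n where "n = length vs"
  let ?A = "adjacency_mat D vs"
  let ?vec = "\<lambda>y. vec n (\<lambda>j. y (vs ! j))"
  have A: "?A \<in> carrier_mat n n"
    by (simp add: adjacency_mat_def n_def)
  have surj: "\<exists>y. x = ?vec y" if "x \<in> carrier_vec n" for x :: "complex vec"
  proof -
    have inj: "inj_on ((!) vs) {..<n}"
      using vs bij_betw_nth[of vs] by (auto simp: n_def bij_betw_def)
    show ?thesis
      using that by (intro exI[of _ "\<lambda>v. x $ inv_into {..<n} ((!) vs) v"] eq_vecI)
        (auto simp: inv_into_f_f[OF inj])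
  qed
  have nz: "?vec y \<noteq> 0\<^sub>v n \<longleftrightarrow> (\<exists>u\<in>pverts D. y u \<noteq> 0)" for y :: "'a \<Rightarrow> complex"
    using vs(2)[symmetric] by (auto simp: n_def set_conv_nth vec_eq_iff)
  have eq: "?A *\<^sub>v ?vec y = c \<cdot>\<^sub>v ?vec y \<longleftrightarrow>
      (\<forall>u\<in>pverts D. (\<Sum>v | v \<in> pverts D \<and> (u, v) \<in> parcs D. y v) = c * y u)" for y
  proof -
    have "?A *\<^sub>v ?vec y = c \<cdot>\<^sub>v ?vec y \<longleftrightarrow>
        (\<forall>i<n. (?A *\<^sub>v ?vec y) $ i = c * y (vs ! i))"
      using A by (auto simp: vec_eq_iff)
    also have "\<dots> \<longleftrightarrow>
        (\<forall>i<n. (\<Sum>v | v \<in> pverts D \<and> (vs ! i, v) \<in> parcs D. y v) = c * y (vs ! i))"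
      using adjacency_mat_mult_vec[OF vs, of _ y] by (simp add: n_def)
    also have "\<dots> \<longleftrightarrow>
        (\<forall>u\<in>set vs. (\<Sum>v | v \<in> pverts D \<and> (u, v) \<in> parcs D. y v) = c * y u)"
      by (auto simp: n_def set_conv_nth)
    finally show ?thesis using vs(2) by simp
  qed
  have "eigenvalue ?A c \<longleftrightarrow> (\<exists>x\<in>carrier_vec n. x \<noteq> 0\<^sub>v n \<and> ?A *\<^sub>v x = c \<cdot>\<^sub>v x)"
    using A by (auto simp: eigenvalue_def eigenvector_def)
  also have "\<dots> \<longleftrightarrow> (\<exists>y. ?vec y \<noteq> 0\<^sub>v n \<and> ?A *\<^sub>v ?vec y = c \<cdot>\<^sub>v ?vec y)"
    using surj by (metis vec_carrier)
  finally show ?thesis unfolding nz eq .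
qed

text \<open>The Collatz-Wielandt upper bound: an eigenvector \<open>y\<close> for an eigenvalue
  \<open>c\<close> of largest modulus is compared with \<open>x\<close> at a vertex where
  \<open>cmod (y u) / x u\<close> attains its maximum \<open>M\<close>. There the triangle
  inequality gives \<open>cmod c * (M * x u) \<le> r * (M * x u)\<close>.\<close>

lemma digraph_spectral_radius_le:
  fixes x :: "'a \<Rightarrow> real"
  assumes fin: "finite (pverts D)" and ne: "pverts D \<noteq> {}"
    and pos: "\<And>u. u \<in> pverts D \<Longrightarrow> x u > 0"
    and le: "\<And>u. u \<in> pverts D \<Longrightarrow>
      (\<Sum>v | v \<in> pverts D \<and> (u, v) \<in> parcs D. x v) \<le> r * x u"
  shows "digraph_spectral_radius D \<le> r"
proof -
  obtain vs where vs: "distinct vs" "set vs = pverts D"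
    using finite_distinct_list[OF fin] by blast
  have A: "adjacency_mat D vs \<in> carrier_mat (length vs) (length vs)"
    by (simp add: adjacency_mat_def)
  have "length vs > 0" using vs ne by auto
  from spectral_radius_mem_max(1)[OF A this] obtain c
    where c: "eigenvalue (adjacency_mat D vs) c"
      "digraph_spectral_radius D = cmod c"
    by (auto simp: digraph_spectral_radius_eq[OF vs] spectrum_def)
  obtain y u\<^sub>0 where y: "u\<^sub>0 \<in> pverts D" "y u\<^sub>0 \<noteq> 0"
    "\<And>u. u \<in> pverts D \<Longrightarrow>
      (\<Sum>v | v \<in> pverts D \<and> (u, v) \<in> parcs D. y v) = c * y u"
    using c(1) unfolding eigenvalue_adjacency_mat_iff[OF vs] by blast
  define M where "M = Max ((\<lambda>u. cmod (y u) / x u) ` pverts D)"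
  have M: "cmod (y u) \<le> M * x u" if "u \<in> pverts D" for u
  proof -
    have "cmod (y u) / x u \<le> M"
      unfolding M_def using that fin by (intro Max_ge) auto
    thus ?thesis using pos[OF that] by (simp add: pos_divide_le_eq)
  qed
  have "M \<in> (\<lambda>u. cmod (y u) / x u) ` pverts D"
    unfolding M_def using fin ne by (intro Max_in) auto
  then obtain u where u: "u \<in> pverts D" "cmod (y u) = M * x u"
    using pos by fastforce
  \<comment> \<open>The nonzero entry of \<open>y\<close> forces \<open>M > 0\<close>, which allows
    multiplying \<open>le\<close> by \<open>M\<close> and cancelling \<open>M * x u\<close> at the
    end.\<close>
  have "0 < M * x u\<^sub>0" using M[OF y(1)] y(2) by (smt (verit) zero_less_norm_iff)
  hence Mpos: "M > 0" using pos[OF y(1)] by (simp add: zero_less_mult_iff)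
  have "cmod c * (M * x u) = cmod (\<Sum>v | v \<in> pverts D \<and> (u, v) \<in> parcs D. y v)"
    using u y(3)[OF u(1)] by (simp add: norm_mult)
  also have "\<dots> \<le> (\<Sum>v | v \<in> pverts D \<and> (u, v) \<in> parcs D. cmod (y v))"
    by (rule norm_sum)
  also have "\<dots> \<le> (\<Sum>v | v \<in> pverts D \<and> (u, v) \<in> parcs D. M * x v)"
    by (rule sum_mono) (use M in auto)
  also have "\<dots> = M * (\<Sum>v | v \<in> pverts D \<and> (u, v) \<in> parcs D. x v)"
    by (simp add: sum_distrib_left)
  also have "\<dots> \<le> M * (r * x u)"
    using le[OF u(1)] Mpos by (intro mult_left_mono) auto
  finally have "cmod c * (M * x u) \<le> r * (M * x u)" by (simp add: mult_ac)
  moreover have "M * x u > 0" using Mpos pos[OF u(1)] by simp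
  ultimately show ?thesis unfolding c(2) by (rule mult_right_le_imp_le)
qed

text \<open>The weights form a real eigenvector, so \<open>r\<close> is an eigenvalue and is at most
  its own modulus.\<close>

lemma digraph_spectral_radius_ge:
  fixes x :: "'a \<Rightarrow> real"
  assumes fin: "finite (pverts D)" and u: "u \<in> pverts D" "x u \<noteq> 0"
    and eq: "\<And>u. u \<in> pverts D \<Longrightarrow>
      (\<Sum>v | v \<in> pverts D \<and> (u, v) \<in> parcs D. x v) = r * x u"
  shows "r \<le> digraph_spectral_radius D"
proof -
  obtain vs where vs: "distinct vs" "set vs = pverts D"
    using finite_distinct_list[OF fin] by blast
  have A: "adjacency_mat D vs \<in> carrier_mat (length vs) (length vs)"
    by (simp add: adjacency_mat_def)
  have "length vs > 0" using vs u by auto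
  have "eigenvalue (adjacency_mat D vs) (of_real r)"
    unfolding eigenvalue_adjacency_mat_iff[OF vs]
    using u eq by (intro exI[of _ "\<lambda>v. complex_of_real (x v)"])
      (auto simp flip: of_real_sum of_real_mult)
  hence "cmod (of_real r) \<le> digraph_spectral_radius D"
    unfolding digraph_spectral_radius_eq[OF vs]
    by (intro spectral_radius_mem_max(2)[OF A \<open>length vs > 0\<close>] imageI) (simp add: spectrum_def)
  thus ?thesis by simp
qed

section \<open>Layered digraphs\<close>

text \<open>Layer 0 stands for the removed set, the positive layers for the ordered blocks. A layer
  function lets an arbitrary digraph be compared with the extremal one while keeping its own vertex
  set.\<close>

definition layered_arcs :: "'a set \<Rightarrow> ('a \<Rightarrow> nat) \<Rightarrow> 'a rel" where
  "layered_arcs V f =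
     {(u, v). u \<in> V \<and> v \<in> V \<and> u \<noteq> v \<and> (f u = 0 \<or> f v = 0 \<or> f u \<le> f v)}"

abbreviation level_card :: "'a set \<Rightarrow> ('a \<Rightarrow> nat) \<Rightarrow> nat \<Rightarrow> nat" where
  "level_card V f i \<equiv> card {v \<in> V. f v = i}"

text \<open>
  Solving the eigenvalue equation for \<open>t - 1\<close> from the last layer upwards, with value \<open>1\<close> on
  layer \<open>0\<close>, gives these weights; only the equation at layer \<open>0\<close> then restricts \<open>t\<close>.
\<close>
definition layer_weight :: "real \<Rightarrow> (nat \<Rightarrow> real) \<Rightarrow> nat \<Rightarrow> nat \<Rightarrow> real" where
  "layer_weight t c l i = (if i = 0 then 1 else c 0 / t * (\<Prod>j\<in>{i..l}. t / (t - c j)))"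

lemma layer_weight_pos:
  assumes "t > 0" "c 0 > 0" "\<And>j. j \<in> {1..l} \<Longrightarrow> c j < t"
  shows "layer_weight t c l i > 0"
  using assms by (auto simp: layer_weight_def intro!: mult_pos_pos prod_pos divide_pos_pos)

text \<open>For \<open>i \<le> l\<close> this is the eigenvalue equation for \<open>t - 1\<close> at
  a vertex of layer \<open>i\<close>, with the vertex's own weight added to both sides. Downward
  induction works because \<open>(t - c i) * w i = t * w (Suc i)\<close>; it starts at
  \<open>i = Suc l\<close>, where the empty product leaves the weight
  \<open>c 0 / t\<close>.\<close>

lemma sum_layer_weight:
  assumes t: "t > 0" "\<And>j. j \<in> {1..l} \<Longrightarrow> c j < t" and i: "1 \<le> i" "i \<le> Suc l"
  shows "c 0 + (\<Sum>j\<in>{i..l}. c j * layer_weight t c l j) = t * layer_weight t c l i"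
  using i(2,1)
proof (induction i rule: inc_induct)
  case base
  show ?case using t by (simp add: layer_weight_def)
next
  case (step i)
  let ?w = "layer_weight t c l"
  have less: "c i < t" using step by (intro t) auto
  have "{i..l} = insert i {Suc i..l}" using step by auto
  hence "?w i = t / (t - c i) * ?w (Suc i)" "(\<Sum>j\<in>{i..l}. c j * ?w j) =
      c i * ?w i + (\<Sum>j\<in>{Suc i..l}. c j * ?w j)"
    using step by (auto simp: layer_weight_def)
  moreover from this(1) have "(t - c i) * ?w i = t * ?w (Suc i)"
    using less by (simp add: field_simps)
  moreover have "c 0 + (\<Sum>j\<in>{Suc i..l}. c j * ?w j) = t * ?w (Suc i)"
    using step by simp
  ultimately show ?case by (simp only: left_diff_distrib)
qed

text \<open>Apart from itself, \<open>u\<close> has arcs to all of layer 0 and to all layers from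
  \<open>max 1 (f u)\<close> on. With \<open>u\<close> included the sum is \<open>t\<close> times a
  weight by \<open>sum_layer_weight\<close>; taking \<open>u\<close> out again subtracts
  \<open>w (f u)\<close>, which turns \<open>t\<close> into \<open>t - 1\<close>.\<close>

lemma sum_layered_arcs:
  assumes V: "finite V" "f ` V \<subseteq> {..l}" "u \<in> V"
    and t: "t > 0" "\<And>j. j \<in> {1..l} \<Longrightarrow> real (level_card V f j) < t"
  defines "w \<equiv> layer_weight t (\<lambda>j. real (level_card V f j)) l"
  shows "(\<Sum>v | v \<in> V \<and> (u, v) \<in> layered_arcs V f. w (f v)) =
    (if f u = 0 then t * w 1 - 1 else (t - 1) * w (f u))"
proof -
  \<comment> \<open>Vertices of layer 0 see the same positive layers as those of layer 1. For
    \<open>l = 0\<close> this gives \<open>i = Suc l\<close>, an empty range.\<close>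
  define i where "i = max 1 (f u)"
  have i: "1 \<le> i" "i \<le> Suc l" using V by (auto simp: i_def)
  have "(\<Sum>v | v \<in> V \<and> f v \<in> {i..l}. w (f v)) =
      (\<Sum>j\<in>{i..l}. \<Sum>v | v \<in> V \<and> f v = j. w (f v))"
    using V by (subst sum.group[symmetric, where g = f and T = "{i..l}"])
      (auto simp del: sum_constant intro!: sum.cong[OF refl sum.cong])
  also have "\<dots> = (\<Sum>j\<in>{i..l}. level_card V f j * w j)"
    by simp
  finally have upper: "(\<Sum>v | v \<in> V \<and> f v \<in> {i..l}. w (f v)) =
      (\<Sum>j\<in>{i..l}. level_card V f j * w j)" .
  have "{v. v \<in> V \<and> (u, v) \<in> layered_arcs V f} =
      ({v \<in> V. f v = 0} \<union> {v \<in> V. f v \<in> {i..l}}) - {u}"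
    using V by (auto simp: layered_arcs_def i_def)
  hence "(\<Sum>v | v \<in> V \<and> (u, v) \<in> layered_arcs V f. w (f v)) =
      (\<Sum>v\<in>({v \<in> V. f v = 0} \<union> {v \<in> V. f v \<in> {i..l}}) - {u}. w (f v))"
    by simp
  also have "\<dots> = (\<Sum>v\<in>{v \<in> V. f v = 0} \<union> {v \<in> V. f v \<in> {i..l}}. w (f v)) - w (f u)"
    using V by (subst sum_diff1) (auto simp: i_def)
  also have "(\<Sum>v\<in>{v \<in> V. f v = 0} \<union> {v \<in> V. f v \<in> {i..l}}. w (f v)) =
      (\<Sum>v | v \<in> V \<and> f v = 0. w (f v)) + (\<Sum>v | v \<in> V \<and> f v \<in> {i..l}. w (f v))"
    using V i by (intro sum.union_disjoint) auto
  also have "(\<Sum>v | v \<in> V \<and> f v = 0. w (f v)) = level_card V f 0"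
    by (simp add: w_def layer_weight_def)
  also have "real (level_card V f 0) + (\<Sum>v | v \<in> V \<and> f v \<in> {i..l}. w (f v)) = t * w i"
    unfolding upper using sum_layer_weight[of t l "\<lambda>j. real (level_card V f j)" i] t i
    by (simp add: w_def)
  finally have "(\<Sum>v | v \<in> V \<and> (u, v) \<in> layered_arcs V f. w (f v)) = t * w i - w (f u)" .
  moreover have "w 0 = 1" by (simp add: w_def layer_weight_def)
  ultimately show ?thesis
    by (auto simp: i_def algebra_simps max_def)
qed

text \<open>Since layer 0 has weight 1, its eigenvalue equation for \<open>t - 1\<close> reads
  \<open>t * w 1 = t\<close>; the closed form turns it into the polynomial equation for
  \<open>t\<close>.\<close>

lemma layer_weight_1:
  assumes "t > 0" "\<And>j. j \<in> {1..l} \<Longrightarrow> c j < t"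
  shows "t * layer_weight t c l 1 = c 0 * t ^ l / (\<Prod>j\<in>{1..l}. t - c j)"
  using assms by (simp add: layer_weight_def prod_dividef)

text \<open>The weights are positive, so missing arcs only lower the neighbour sums; at layer 0 the
  hypothesis \<open>le\<close> amounts to \<open>t * w 1 \<le> t\<close>.\<close>

lemma layered_digraph_spectral_radius_le:
  assumes V: "finite (pverts D)" "f ` pverts D \<subseteq> {..l}"
    and arcs: "parcs D \<subseteq> layered_arcs (pverts D) f"
    and c: "\<And>j. c j = real (level_card (pverts D) f j)" and "c 0 > 0"
    and t: "t > 0" "\<And>j. j \<in> {1..l} \<Longrightarrow> c j < t"
    and le: "c 0 * t ^ l \<le> t * (\<Prod>j\<in>{1..l}. t - c j)"
  shows "digraph_spectral_radius D \<le> t - 1"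
proof (rule digraph_spectral_radius_le)
  let ?w = "layer_weight t c l"
  have c_eq: "(\<lambda>j. real (level_card (pverts D) f j)) = c" using c by auto
  have pos: "?w i > 0" for i
    using \<open>c 0 > 0\<close> t by (intro layer_weight_pos) auto
  have "(\<Prod>j\<in>{1..l}. t - c j) > 0" using t by (intro prod_pos) auto
  hence "c 0 * t ^ l / (\<Prod>j\<in>{1..l}. t - c j) \<le> t"
    using le by (simp only: pos_divide_le_eq)
  hence w1: "t * ?w 1 \<le> t"
    using layer_weight_1[of t l c] t by simp
  show "finite (pverts D)" by fact
  have "level_card (pverts D) f 0 \<noteq> 0" using c \<open>c 0 > 0\<close> by (metis less_irrefl of_nat_0)
  thus "pverts D \<noteq> {}" by auto
  fix u assume u: "u \<in> pverts D"
  show "?w (f u) > 0" by (rule pos)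
  have "(\<Sum>v | v \<in> pverts D \<and> (u, v) \<in> parcs D. ?w (f v)) \<le>
      (\<Sum>v | v \<in> pverts D \<and> (u, v) \<in> layered_arcs (pverts D) f. ?w (f v))"
    using V arcs by (intro sum_mono2) (auto intro: less_imp_le[OF pos])
  also have "\<dots> = (if f u = 0 then t * ?w 1 - 1 else (t - 1) * ?w (f u))"
    using sum_layered_arcs[OF V u t(1)] t(2) by (simp add: c_eq flip: c)
  also have "\<dots> \<le> (t - 1) * ?w (f u)"
    using w1 by (auto simp: layer_weight_def)
  finally show "(\<Sum>v | v \<in> pverts D \<and> (u, v) \<in> parcs D. ?w (f v)) \<le> (t - 1) * ?w (f u)" .
qed

text \<open>With all layered arcs present and \<open>t\<close> a root, the estimates of the upper
  bound become equalities, so the layer weights are an eigenvector for \<open>t - 1\<close>.\<close>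

lemma layered_digraph_spectral_radius_ge:
  assumes V: "finite (pverts D)" "f ` pverts D \<subseteq> {..l}"
    and arcs: "parcs D = layered_arcs (pverts D) f"
    and c: "\<And>j. c j = real (level_card (pverts D) f j)" and "c 0 > 0"
    and t: "t > 0" "\<And>j. j \<in> {1..l} \<Longrightarrow> c j < t"
    and eq: "c 0 * t ^ l = t * (\<Prod>j\<in>{1..l}. t - c j)"
  shows "t - 1 \<le> digraph_spectral_radius D"
proof -
  let ?w = "layer_weight t c l"
  have c_eq: "(\<lambda>j. real (level_card (pverts D) f j)) = c" using c by auto
  have "(\<Prod>j\<in>{1..l}. t - c j) > 0" using t by (intro prod_pos) auto
  hence "c 0 * t ^ l / (\<Prod>j\<in>{1..l}. t - c j) = t"
    using eq by (metis less_irrefl nonzero_mult_div_cancel_right)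
  hence w1: "t * ?w 1 = t"
    using layer_weight_1[of t l c] t by simp
  have "level_card (pverts D) f 0 \<noteq> 0" using c \<open>c 0 > 0\<close> by (metis less_irrefl of_nat_0)
  then obtain u\<^sub>0 where "u\<^sub>0 \<in> pverts D" by fastforce
  moreover have "?w (f u\<^sub>0) \<noteq> 0"
    using layer_weight_pos[of t c l] \<open>c 0 > 0\<close> t by (metis less_irrefl)
  moreover have "(\<Sum>v | v \<in> pverts D \<and> (u, v) \<in> parcs D. ?w (f v)) = (t - 1) * ?w (f u)"
    if u: "u \<in> pverts D" for u
  proof -
    have "(\<Sum>v | v \<in> pverts D \<and> (u, v) \<in> parcs D. ?w (f v)) =
        (if f u = 0 then t * ?w 1 - 1 else (t - 1) * ?w (f u))"
      using sum_layered_arcs[OF V u t(1)] t(2) by (simp add: c_eq arcs flip: c)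
    thus ?thesis using w1 by (auto simp: layer_weight_def)
  qed
  ultimately show ?thesis
    by (intro digraph_spectral_radius_ge[OF V(1), where x = "\<lambda>v. ?w (f v)"]) auto
qed

section \<open>The extremal parameter\<close>

text \<open>For \<open>s > 0\<close>, division by \<open>s ^ (card I + 1)\<close> gives the familiar
  form: the product of the \<open>1 - m i / s\<close> is at least one minus the sum of the
  \<open>m i / s\<close>.\<close>

lemma weierstrass_product_inequality:
  fixes s :: real
  assumes "finite I" "\<And>i. i \<in> I \<Longrightarrow> m i \<ge> 0" "sum m I \<le> s"
  shows "s ^ card I * (s - sum m I) \<le> s * (\<Prod>i\<in>I. s - m i)"
  using assms
proof (induction I rule: finite_induct)
  case empty
  thus ?case by simp
next
  case (insert a I)
  have "m a \<ge> 0" "sum m I \<ge> 0" "m a + sum m I \<le> s"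
    using insert sum_nonneg[of I m] by auto
  hence nonneg: "m a \<ge> 0" "sum m I \<ge> 0" "s \<ge> 0" "m a \<le> s" "sum m I \<le> s"
    by linarith+
  have "s ^ card (insert a I) * (s - sum m (insert a I)) =
      s ^ card I * (s * (s - m a - sum m I))"
    using insert by (simp add: algebra_simps)
  \<comment> \<open>The two second factors differ by \<open>m a * sum m I\<close>, which is
    nonnegative.\<close>
  also have "\<dots> \<le> s ^ card I * ((s - m a) * (s - sum m I))"
    using nonneg by (intro mult_left_mono) (auto simp: algebra_simps)
  also have "\<dots> = (s - m a) * (s ^ card I * (s - sum m I))" by simp
  also have "\<dots> \<le> (s - m a) * (s * (\<Prod>i\<in>I. s - m i))"
    using insert nonneg by (intro mult_left_mono insert.IH) auto
  also have "\<dots> = s * (\<Prod>i\<in>insert a I. s - m i)"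
    using insert by simp
  finally show ?case .
qed

text \<open>The Weierstrass inequality for the surpluses \<open>c i - 1\<close> and
  \<open>s = t - 1\<close>: the surpluses sum to \<open>N - 1\<close>, which leaves
  \<open>t - N\<close>, and one factor \<open>t - 1\<close> cancels. The left-hand side belongs to
  the sizes with the whole surplus in one layer.\<close>

lemma prod_shifted_ge:
  fixes t N :: real
  assumes I: "finite I" "I \<noteq> {}" and c: "\<And>i. i \<in> I \<Longrightarrow> c i \<ge> 1"
    and sum: "sum c I = N + real (card I - 1)" and t: "N < t" "1 < t"
  shows "(t - N) * (t - 1) ^ (card I - 1) \<le> (\<Prod>i\<in>I. t - c i)"
proof -
  have card: "card I = Suc (card I - 1)" using I by (simp add: card_gt_0_iff)
  have "sum (\<lambda>i. c i - 1) I = N - 1"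
    using sum card by (simp add: sum_subtractf)
  hence "(t - 1) ^ card I * (t - N) \<le> (t - 1) * (\<Prod>i\<in>I. t - c i)"
    using weierstrass_product_inequality[of I "\<lambda>i. c i - 1" "t - 1"] I c t by simp
  hence "(t - 1) * ((t - N) * (t - 1) ^ (card I - 1)) \<le> (t - 1) * (\<Prod>i\<in>I. t - c i)"
    by (subst (asm) card) (simp add: mult_ac)
  thus ?thesis using t by simp
qed

text \<open>After cancelling a factor \<open>t\<close>, the intermediate value theorem applies
  between \<open>N\<close> and a sufficiently large \<open>b\<close>.\<close>

lemma extremal_root_exists:
  fixes k N :: real
  assumes "k > 0" "N \<ge> 1" "l \<ge> 2"
  shows "\<exists>t>N. k * t ^ l = t * ((t - N) * (t - 1) ^ (l - 1))"
proof -
  define g where "g t = (t - N) * (t - 1) ^ (l - 1) - k * t ^ (l - 1)" for t :: real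
  \<comment> \<open>Chosen so that \<open>b - N \<ge> k * 2 ^ (l - 1)\<close> and, because
    \<open>b \<ge> 2\<close>, also \<open>b - 1 \<ge> b / 2\<close>; multiplying these bounds gives
    \<open>g b \<ge> 0\<close>.\<close>
  define b where "b = N + k * 2 ^ (l - 1) + 1"
  have "k * 2 ^ (l - 1) \<ge> 0" using assms by simp
  hence b: "b \<ge> N" "b \<ge> 2" using assms(2) by (auto simp: b_def)
  have "k * b ^ (l - 1) = (k * 2 ^ (l - 1)) * (b / 2) ^ (l - 1)"
    by (simp add: power_divide)
  also have "\<dots> \<le> (b - N) * (b - 1) ^ (l - 1)"
    using b assms by (intro mult_mono power_mono) (auto simp: b_def)
  finally have "g b \<ge> 0" by (simp add: g_def)
  moreover have gN: "g N < 0" using assms by (simp add: g_def)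
  ultimately obtain t where t: "N \<le> t" "t \<le> b" "g t = 0"
    using IVT'[of g N 0 b] b by (force simp: g_def intro!: continuous_intros)
  \<comment> \<open>The inequality \<open>t > N\<close> has to be strict: it keeps the factors
    \<open>t - c j\<close> positive later.\<close>
  hence "t \<noteq> N" using gN by auto
  moreover have "k * t ^ l = t * (k * t ^ (l - 1))"
    using assms by (simp flip: power_Suc)
  ultimately show ?thesis using t by (intro exI[of _ t]) (auto simp: g_def)
qed

section \<open>Layering by strongly connected components\<close>

text \<open>Induction on \<open>l\<close>: a class that reaches nothing outside itself is peeled off
  as the last layer, at the cost of at most one class. All classes left at the end merge into layer
  1.\<close>

lemma preorder_layering:
  assumes "finite W" "\<And>u. u \<in> W \<Longrightarrow> R u u"
    and "\<And>u v w. u \<in> W \<Longrightarrow> v \<in> W \<Longrightarrow> w \<in> W \<Longrightarrow> R u v \<Longrightarrow> R v w \<Longrightarrow> R u w"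
    and "Suc l \<le> card ((\<lambda>u. {v \<in> W. R u v \<and> R v u}) ` W)"
  shows "\<exists>f. f ` W = {1..Suc l} \<and> (\<forall>u\<in>W. \<forall>v\<in>W. R u v \<longrightarrow> f u \<le> f v)"
  using assms
proof (induction l arbitrary: W)
  case 0
  hence "W \<noteq> {}" by auto
  thus ?case by (intro exI[of _ "\<lambda>_. 1"]) auto
next
  case (Suc l)
  note refl = Suc.prems(2) and trans = Suc.prems(3)
  define up where "up u = {v \<in> W. R u v}" for u
  have "W \<noteq> {}" using Suc.prems(4) by auto
  then obtain m where m: "m \<in> W" "\<And>u. u \<in> W \<Longrightarrow> card (up m) \<le> card (up u)"
    using arg_min_nat_lemma[of "\<lambda>u. u \<in> W" _ "\<lambda>u. card (up u)"] by blast
  \<comment> \<open>By minimality the up-set of \<open>m\<close> is a single class; it becomes the last layer.\<close>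
  have up_reaches: "R v m" if "v \<in> up m" for v
  proof -
    have v: "v \<in> W" "R m v" using that by (auto simp: up_def)
    have "up v \<subseteq> up m" using trans[OF m(1) v(1)] v(2) by (auto simp: up_def)
    moreover have "finite (up m)" using Suc.prems(1) by (simp add: up_def)
    ultimately have "up v = up m" using m(2)[OF v(1)] by (intro card_seteq) auto
    thus ?thesis using m(1) refl[of m] by (auto simp: up_def)
  qed
  define W' where "W' = W - up m"
  have sub: "W' \<subseteq> W" by (auto simp: W'_def)
  let ?cl = "\<lambda>W u. {v \<in> W. R u v \<and> R v u}"
  have up_m: "?cl W u = up m" if "u \<in> up m" for u
    using that up_reaches trans m(1) by (auto simp: up_def)
  \<comment> \<open>A vertex reaching \<open>u\<close> cannot lie in \<open>up m\<close>, since then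
    \<open>m\<close> would reach \<open>u\<close>. So removing \<open>up m\<close> leaves the other
    classes intact.\<close>
  have cl: "?cl W u = ?cl W' u" if "u \<in> W'" for u
  proof -
    have u: "u \<in> W" "\<not> R m u" using that by (auto simp: W'_def up_def)
    have "\<not> R m v" if "v \<in> W" "R v u" for v
      using trans[OF m(1) that(1) u(1)] that(2) u(2) by blast
    thus ?thesis by (auto simp: W'_def up_def)
  qed
  have "?cl W ` W \<subseteq> insert (up m) (?cl W' ` W')"
  proof
    fix X assume "X \<in> ?cl W ` W"
    then obtain u where "u \<in> W" "X = ?cl W u" by blast
    thus "X \<in> insert (up m) (?cl W' ` W')"
      using up_m[of u] cl[of u] by (cases "u \<in> up m") (auto simp: W'_def)
  qed
  hence "card (?cl W ` W) \<le> card (insert (up m) (?cl W' ` W'))"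
    using Suc.prems(1) sub by (intro card_mono) (auto intro: finite_subset)
  also have "\<dots> \<le> Suc (card (?cl W' ` W'))" by (rule card_insert_le_m1) auto
  finally have card: "Suc l \<le> card (?cl W' ` W')" using Suc.prems(4) by simp
  obtain f where f: "f ` W' = {1..Suc l}" "\<forall>u\<in>W'. \<forall>v\<in>W'. R u v \<longrightarrow> f u \<le> f v"
  proof (atomize_elim, rule Suc.IH)
    show "finite W'" using sub Suc.prems(1) by (rule finite_subset)
    show "R u u" if "u \<in> W'" for u
      using refl that sub by blast
    show "R u w" if "u \<in> W'" "v \<in> W'" "w \<in> W'" "R u v" "R v w" for u v w
      using trans[of u v w] that sub by blast
  qed (rule card)
  define f' where "f' u = (if u \<in> up m then Suc (Suc l) else f u)" for u
  have W_eq: "W = W' \<union> up m" by (auto simp: W'_def up_def)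
  have "m \<in> up m" using m(1) refl by (auto simp: up_def)
  hence "f' ` up m = {Suc (Suc l)}" by (auto simp: f'_def)
  moreover have "f' ` W' = f ` W'" by (auto simp: f'_def W'_def)
  ultimately have img: "f' ` W = {1..Suc (Suc l)}"
    unfolding W_eq image_Un f(1) by auto
  have "f' u \<le> f' v" if uv: "u \<in> W" "v \<in> W" "R u v" for u v
  proof (cases "v \<in> up m")
    case True
    have "f' u \<in> {1..Suc (Suc l)}" using uv(1) img by blast
    thus ?thesis using True by (simp add: f'_def)
  next
    case False
    hence "u \<notin> up m" using uv trans[OF m(1), of u v] by (auto simp: up_def)
    thus ?thesis using False uv f(2) by (auto simp: f'_def W'_def)
  qed
  thus ?case using img by blast
qed

text \<open>The classes of mutual reachability are the vertex sets of the strong components, so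
  \<open>preorder_layering\<close> applies to reachability, with \<open>l\<close> written as
  \<open>Suc (l - 1)\<close>.\<close>

lemma (in wf_digraph) layering_exists:
  assumes "finite (verts G)" "1 \<le> l" "l \<le> card sccs"
  shows "\<exists>f. f ` verts G = {1..l} \<and> (\<forall>u v. u \<rightarrow>\<^bsub>G\<^esub> v \<longrightarrow> f u \<le> f v)"
proof -
  have "scc_of u = {v \<in> verts G. u \<rightarrow>\<^sup>* v \<and> v \<rightarrow>\<^sup>* u}" for u
    using reachable_in_verts by (auto simp: scc_of_def)
  hence card: "Suc (l - 1) \<le> card ((\<lambda>u. {v \<in> verts G. u \<rightarrow>\<^sup>* v \<and> v \<rightarrow>\<^sup>* u}) ` verts G)"
    using assms by (simp flip: card_sccs_verts add: sccs_verts_conv_scc_of)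
  have "\<exists>f. f ` verts G = {1..Suc (l - 1)} \<and>
      (\<forall>u\<in>verts G. \<forall>v\<in>verts G. u \<rightarrow>\<^sup>* v \<longrightarrow> f u \<le> f v)"
  proof (rule preorder_layering[OF assms(1)])
    show "u \<rightarrow>\<^sup>* w" if "u \<rightarrow>\<^sup>* v" "v \<rightarrow>\<^sup>* w" for u v w
      using that by (rule reachable_trans)
  qed (use card in simp_all)
  then obtain f where f: "f ` verts G = {1..Suc (l - 1)}"
    and mono: "\<forall>u\<in>verts G. \<forall>v\<in>verts G. u \<rightarrow>\<^sup>* v \<longrightarrow> f u \<le> f v"
    by blast
  have "f u \<le> f v" if "u \<rightarrow>\<^bsub>G\<^esub> v" for u v
    using mono adj_in_verts[OF that] reachable_adjI[OF that] by blast
  thus ?thesis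
    using f assms(2) by auto
qed

section \<open>From a minimum separating set to a layering of the whole digraph\<close>

lemma arcs_ends_induce_with_proj:
  "arcs_ends (with_proj D \<restriction> W) = {(u, v) \<in> parcs D. u \<in> W \<and> v \<in> W}"
  by (force simp: arcs_ends_def arc_to_ends_def induce_subgraph_def)

text \<open>A set \<open>S\<close> attaining the minimum becomes layer 0. As
  \<open>\<kappa> + l \<le> n\<close>, at least \<open>l\<close> vertices remain, so the condition
  on \<open>S\<close> must hold through the number of components, and these supply the layers
  \<open>1..l\<close>.\<close>

lemma l_connectivity_layering:
  assumes "D \<in> digraphs_of_l_connectivity l n \<kappa>" "1 \<le> l" "\<kappa> + l \<le> n"
  obtains f where "f ` pverts D \<subseteq> {..l}" "{1..l} \<subseteq> f ` pverts D"
    "parcs D \<subseteq> layered_arcs (pverts D) f" "level_card (pverts D) f 0 = \<kappa>"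
proof -
  interpret pair_digraph D
    using assms(1) by (simp add: digraphs_of_l_connectivity_def)
  let ?V = "pverts D"
  let ?P = "\<lambda>m. \<exists>S\<subseteq>?V. card S = m \<and>
    (l \<le> card (pre_digraph.sccs (with_proj D \<restriction> (?V - S))) \<or> card (?V - S) < l)"
  have D: "card ?V = n" "\<kappa> = (LEAST m. ?P m)"
    using assms(1) by (auto simp: digraphs_of_l_connectivity_def l_connectivity_def)
  \<comment> \<open>Removing everything leaves \<open>0 < l\<close> vertices, so the minimum is
    attained.\<close>
  have "?P (card ?V)" using assms(2) by (intro exI[of _ ?V]) auto
  hence "?P \<kappa>" unfolding D(2) by (rule LeastI)
  then obtain S where S: "S \<subseteq> ?V" "card S = \<kappa>"
    "l \<le> card (pre_digraph.sccs (with_proj D \<restriction> (?V - S))) \<or> card (?V - S) < l"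
    by blast
  have finS: "finite S" using S(1) pair_finite_verts by (rule finite_subset)
  have "card (?V - S) = n - \<kappa>" using S D finS by (simp add: card_Diff_subset)
  hence sccs: "l \<le> card (pre_digraph.sccs (with_proj D \<restriction> (?V - S)))"
    using S(3) assms(3) by auto
  interpret H: wf_digraph "with_proj D \<restriction> (?V - S)" by (rule wellformed_induce_subgraph)
  obtain g where g: "g ` (?V - S) = {1..l}"
    "\<And>u v. (u, v) \<in> parcs D \<Longrightarrow> u \<in> ?V - S \<Longrightarrow> v \<in> ?V - S \<Longrightarrow> g u \<le> g v"
    using H.layering_exists[OF _ assms(2) sccs] pair_finite_verts
    by (auto simp: arcs_ends_induce_with_proj)
  define f where "f u = (if u \<in> S then 0 else g u)" for u
  have img: "f ` (?V - S) = {1..l}" using g(1) by (auto simp: f_def)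
  have "f ` S \<subseteq> {0}" by (auto simp: f_def)
  moreover have "?V = S \<union> (?V - S)" using S(1) by auto
  ultimately have "f ` ?V \<subseteq> {..l}" by (metis (no_types, lifting) Un_least atMost_iff
    atLeastAtMost_iff image_Un img le0 singletonD subset_iff)
  moreover have "{1..l} \<subseteq> f ` ?V" using img by blast
  moreover have "parcs D \<subseteq> layered_arcs ?V f"
    using g(2) pair_no_loops in_arcsD1 in_arcsD2
    by (fastforce simp: layered_arcs_def f_def)
  moreover have "{v \<in> ?V. f v = 0} = S"
    using S(1) img by (force simp: f_def)
  ultimately show ?thesis using S(2) that[of f] by simp
qed

section \<open>The extremal digraph\<close>

lemma pverts_G_digraph:
  "pverts (G_digraph k l ns) = {(i, x). i \<le> l \<and> x < (if i = 0 then k else ns i)}"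
  by (auto simp: G_digraph_def Let_def digraph_join_def digraph_UN_def complete_on_def block_def
      split: if_splits)

text \<open>The block index serves as the layer: the join gives the arcs between block 0 and the
  rest, the complete digraphs those inside a block, and \<open>F\<close> those to a later block.
  This makes the layered bounds applicable.\<close>

lemma parcs_G_digraph:
  "parcs (G_digraph k l ns) = layered_arcs (pverts (G_digraph k l ns)) fst"
proof (rule Set.set_eqI, simp only: split_paired_all)
  fix i x j y
  have "((i, x), (j, y)) \<in> parcs (G_digraph k l ns) \<longleftrightarrow>
      i = 0 \<and> j = 0 \<and> x < k \<and> y < k \<and> x \<noteq> y \<or>
      1 \<le> i \<and> i \<le> l \<and> i = j \<and> x < ns i \<and> y < ns i \<and> x \<noteq> y \<or>
      i = 0 \<and> x < k \<and> 1 \<le> j \<and> j \<le> l \<and> y < ns j \<or>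
      1 \<le> i \<and> i \<le> l \<and> x < ns i \<and> j = 0 \<and> y < k \<or>
      1 \<le> i \<and> i < j \<and> j \<le> l \<and> x < ns i \<and> y < ns j"
    unfolding G_digraph_def Let_def digraph_join_def digraph_UN_def complete_on_def block_def
    by auto
  also have "\<dots> \<longleftrightarrow> ((i, x), (j, y)) \<in> layered_arcs (pverts (G_digraph k l ns)) fst"
    unfolding pverts_G_digraph layered_arcs_def
    by (cases "i = 0"; cases "j = 0"; cases i j rule: linorder_cases) auto
  finally show "((i, x), (j, y)) \<in> parcs (G_digraph k l ns) \<longleftrightarrow>
    ((i, x), (j, y)) \<in> layered_arcs (pverts (G_digraph k l ns)) fst" .
qed

lemma level_card_G_digraph:
  assumes "i \<le> l"
  shows "level_card (pverts (G_digraph k l ns)) fst i = (if i = 0 then k else ns i)"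
proof -
  have "{v \<in> pverts (G_digraph k l ns). fst v = i} = {i} \<times> {..<(if i = 0 then k else ns i)}"
    using assms by (auto simp: pverts_G_digraph)
  thus ?thesis by (simp add: card_cartesian_product)
qed

lemma pverts_G_digraph_Sigma:
  "pverts (G_digraph k l ns) = (SIGMA i:{..l}. {..<(if i = 0 then k else ns i)})"
  by (auto simp: pverts_G_digraph)

lemma finite_pverts_G_digraph: "finite (pverts (G_digraph k l ns))"
  by (simp add: pverts_G_digraph_Sigma)

lemma card_pverts_G_digraph: "card (pverts (G_digraph k l ns)) = k + (\<Sum>i\<in>{1..l}. ns i)"
proof -
  have "{..l} = insert 0 {1..l}" by auto
  thus ?thesis by (simp add: pverts_G_digraph_Sigma)
qed

section \<open>Strong connectivity and l-connectivity of the extremal digraph\<close>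

lemma pair_digraph_G_digraph: "pair_digraph (G_digraph k l ns)"
proof
  show "finite (parcs (G_digraph k l ns))"
    by (rule finite_subset[of _ "pverts (G_digraph k l ns) \<times> pverts (G_digraph k l ns)"])
      (auto simp: parcs_G_digraph layered_arcs_def finite_pverts_G_digraph)
qed (auto simp: parcs_G_digraph layered_arcs_def finite_pverts_G_digraph)

text \<open>The vertex \<open>z\<close> of block 0 is joined in both directions to every other
  vertex of \<open>W\<close>, so any two vertices are connected through it.\<close>

lemma strongly_connected_induce_G_digraph:
  assumes W: "W \<subseteq> pverts (G_digraph k l ns)" and z: "z \<in> W" "fst z = 0"
  shows "strongly_connected (with_proj (G_digraph k l ns) \<restriction> W)"
proof -
  interpret pair_digraph "G_digraph k l ns" by (rule pair_digraph_G_digraph)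
  let ?H = "with_proj (G_digraph k l ns) \<restriction> W"
  interpret H: wf_digraph ?H by (rule wellformed_induce_subgraph)
  have arcs: "(u, v) \<in> arcs_ends ?H" if "u \<in> W" "v \<in> W" "u \<noteq> v" "fst u = 0 \<or> fst v = 0" for u v
    using that W by (auto simp: arcs_ends_induce_with_proj parcs_G_digraph layered_arcs_def)
  have "u \<rightarrow>\<^sup>*\<^bsub>?H\<^esub> z \<and> z \<rightarrow>\<^sup>*\<^bsub>?H\<^esub> u" if "u \<in> W" for u
    using that z arcs[of u z] arcs[of z u] by (cases "u = z") auto
  hence "u \<rightarrow>\<^sup>*\<^bsub>?H\<^esub> v" if "u \<in> W" "v \<in> W" for u v
    using that H.reachable_trans[of u z v] by blast
  thus ?thesis using z(1) by (intro strongly_connectedI) auto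
qed

text \<open>Without block 0, the block index never decreases along a path, so the vertices
  \<open>(i, 0)\<close> lie in pairwise different components.\<close>

lemma card_sccs_G_digraph_layers:
  fixes k l :: nat and ns :: "nat \<Rightarrow> nat"
  assumes "\<And>i. i \<in> {1..l} \<Longrightarrow> ns i \<ge> 1"
  defines "V \<equiv> pverts (G_digraph k l ns)"
  shows "l \<le> card (pre_digraph.sccs (with_proj (G_digraph k l ns) \<restriction> (V - block 0 k)))"
proof -
  interpret pair_digraph "G_digraph k l ns" by (rule pair_digraph_G_digraph)
  let ?H = "with_proj (G_digraph k l ns) \<restriction> (V - block 0 k)"
  interpret H: wf_digraph ?H by (rule wellformed_induce_subgraph)
  have mono: "fst u \<le> fst v" if "u \<rightarrow>\<^sup>*\<^bsub>?H\<^esub> v" for u v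
    using that
  proof (induction rule: H.converse_reachable_induct)
    case (step u w)
    hence "fst u \<le> fst w"
      by (auto simp: arcs_ends_induce_with_proj parcs_G_digraph layered_arcs_def V_def
          pverts_G_digraph block_def)
    thus ?case using step by simp
  qed auto
  have mem: "(i, 0) \<in> verts ?H" if "i \<in> {1..l}" for i
    using that assms(1)[OF that] by (auto simp: V_def pverts_G_digraph block_def)
  have inj: "inj_on (\<lambda>i. H.scc_of (i, 0)) {1..l}"
  proof (rule inj_onI)
    fix i j assume "i \<in> {1..l}" "j \<in> {1..l}" "H.scc_of (i, 0) = H.scc_of (j, 0)"
    hence "(i, 0) \<in> H.scc_of (j, 0)" using H.in_scc_of_self[OF mem] by metis
    thus "i = j" by (force simp: H.scc_of_def dest!: mono)
  qed
  have "finite H.sccs_verts"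
    unfolding H.sccs_verts_conv_scc_of by (simp add: V_def finite_pverts_G_digraph)
  hence "card ((\<lambda>i. H.scc_of (i, 0)) ` {1..l}) \<le> card H.sccs_verts"
    using mem by (intro card_mono) (auto intro: H.scc_of_in_sccs_verts)
  thus ?thesis unfolding card_image[OF inj] H.card_sccs_verts by simp
qed

text \<open>Removing block 0 shows that \<open>k\<close> vertices suffice. Fewer than
  \<open>k\<close> vertices miss some vertex of block 0, so the rest is strongly connected with a
  single component, while more than \<open>l\<close> vertices survive.\<close>

lemma G_digraph_in_digraphs_of_l_connectivity:
  assumes l: "l \<ge> 2" and k: "k \<ge> 1" and ns: "\<And>i. i \<in> {1..l} \<Longrightarrow> ns i \<ge> 1"
    and n: "n = k + (\<Sum>i\<in>{1..l}. ns i)"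
  shows "G_digraph k l ns \<in> digraphs_of_l_connectivity l n k"
proof -
  let ?G = "G_digraph k l ns"
  let ?V = "pverts ?G"
  interpret pair_digraph ?G by (rule pair_digraph_G_digraph)
  have block0: "block 0 k \<subseteq> ?V" "card (block 0 k) = k"
    by (auto simp: block_def pverts_G_digraph card_cartesian_product)
  have "with_proj ?G \<restriction> ?V = with_proj ?G"
    by (auto simp: induce_subgraph_def with_proj_def dest: in_arcsD1 in_arcsD2)
  moreover have "(0, 0) \<in> ?V" using k by (auto simp: pverts_G_digraph)
  ultimately have sc: "strongly_connected (with_proj ?G)"
    using strongly_connected_induce_G_digraph[of ?V k l ns "(0, 0)"] by simp
  have "l_connectivity l ?G = k"
    unfolding l_connectivity_def
  proof (rule Least_equality)
    show "\<exists>S\<subseteq>?V. card S = k \<and>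
        (l \<le> card (pre_digraph.sccs (with_proj ?G \<restriction> (?V - S))) \<or> card (?V - S) < l)"
      using block0 card_sccs_G_digraph_layers[of l ns k] ns
      by (intro exI[of _ "block 0 k"]) simp
  next
    fix m
    assume "\<exists>S\<subseteq>?V. card S = m \<and>
        (l \<le> card (pre_digraph.sccs (with_proj ?G \<restriction> (?V - S))) \<or> card (?V - S) < l)"
    then obtain S where S: "S \<subseteq> ?V" "card S = m"
      "l \<le> card (pre_digraph.sccs (with_proj ?G \<restriction> (?V - S))) \<or> card (?V - S) < l"
      by blast
    show "k \<le> m"
    proof (rule ccontr)
      assume "\<not> k \<le> m"
      have fin: "finite S" using S(1) finite_pverts_G_digraph by (rule finite_subset)
      have "\<not> block 0 k \<subseteq> S"
        using card_mono[OF fin, of "block 0 k"] block0 S(2) \<open>\<not> k \<le> m\<close> by auto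
      then obtain z where "z \<in> block 0 k" "z \<notin> S" by blast
      hence z: "z \<in> ?V - S" "fst z = 0"
        using block0(1) by (auto simp: block_def)
      interpret H: wf_digraph "with_proj ?G \<restriction> (?V - S)" by (rule wellformed_induce_subgraph)
      have "card H.sccs = 1"
        using strongly_connected_induce_G_digraph[OF _ z] H.strongly_connected_eq_iff by simp
      moreover have "l \<le> (\<Sum>i\<in>{1..l}. ns i)"
        using sum_mono[of "{1..l}" "\<lambda>_. 1" ns] ns by simp
      moreover have "card (?V - S) = k + (\<Sum>i\<in>{1..l}. ns i) - m"
        using S fin by (simp add: card_Diff_subset card_pverts_G_digraph)
      ultimately show False using S(3) l \<open>\<not> k \<le> m\<close> by auto
    qed
  qed
  thus ?thesis
    using sc pair_digraph_G_digraph card_pverts_G_digraph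
    by (auto simp: digraphs_of_l_connectivity_def n)
qed

section \<open>Comparison of an arbitrary digraph of the class with the extremal one\<close>

theorem theorem1p2:
  fixes l \<kappa> n :: nat and ns :: "nat \<Rightarrow> nat"
  assumes "l \<ge> 2" and "\<kappa> \<ge> 1" and "n \<ge> \<kappa> + l"
    and "\<exists>i\<in>{1..l}. ns i = n - \<kappa> - l + 1 \<and> (\<forall>j\<in>{1..l} - {i}. ns j = 1)"
  shows "G_digraph \<kappa> l ns \<in> digraphs_of_l_connectivity l n \<kappa> \<and>
    (\<forall>D \<in> (digraphs_of_l_connectivity l n \<kappa> :: 'a pair_pre_digraph set).
       digraph_spectral_radius D \<le> digraph_spectral_radius (G_digraph \<kappa> l ns))"
proof -
  define N where "N = n - \<kappa> - l + 1"
  obtain i where i: "i \<in> {1..l}" "ns i = N" "\<And>j. j \<in> {1..l} - {i} \<Longrightarrow> ns j = 1"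
    using assms(4) by (auto simp: N_def)
  have N: "N \<ge> 1" "n = \<kappa> + N + (l - 1)" using assms by (auto simp: N_def)
  have card: "card ({1..l} - {i}) = l - 1" using i(1) by simp
  have sum_ns: "(\<Sum>j\<in>{1..l}. ns j) = N + (l - 1)"
    using sum.remove[of "{1..l}" i ns] i card by simp
  have ns: "1 \<le> ns j" "ns j \<le> N" if "j \<in> {1..l}" for j
    using that i(2,3) N(1) by (cases "j = i"; simp)+
  \<comment> \<open>This \<open>t\<close> is the root for the extremal sizes; all digraphs of the
    class are compared at this one value.\<close>
  obtain t :: real where t: "t > real N"
    "\<kappa> * t ^ l = t * ((t - real N) * (t - 1) ^ (l - 1))"
    using extremal_root_exists[of "real \<kappa>" "real N" l] assms N(1) by force
  have t1: "t > 1" using t(1) N(1) by simp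
  let ?G = "G_digraph \<kappa> l ns"
  \<comment> \<open>The product over the layers is the same for every position \<open>i\<close> of
    the large block.\<close>
  have G_ge: "t - 1 \<le> digraph_spectral_radius ?G"
  proof (rule layered_digraph_spectral_radius_ge[OF _ _ parcs_G_digraph refl])
    have "(\<Prod>j\<in>{1..l}. t - real (ns j)) = (t - real N) * (t - 1) ^ (l - 1)"
      using prod.remove[of "{1..l}" i "\<lambda>j. t - real (ns j)"] i card by simp
    moreover have "(\<Prod>j\<in>{1..l}. t - real (level_card (pverts ?G) fst j)) =
        (\<Prod>j\<in>{1..l}. t - real (ns j))"
      by (intro prod.cong) (auto simp: level_card_G_digraph)
    ultimately show "real (level_card (pverts ?G) fst 0) * t ^ l =
        t * (\<Prod>j\<in>{1..l}. t - real (level_card (pverts ?G) fst j))"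
      using t(2) by (simp add: level_card_G_digraph)
    show "real (level_card (pverts ?G) fst j) < t" if "j \<in> {1..l}" for j
      using ns(2)[OF that] that t(1) by (simp add: level_card_G_digraph)
    show "fst ` pverts ?G \<subseteq> {..l}" by (auto simp: pverts_G_digraph)
  qed (use assms t1 in \<open>simp_all add: finite_pverts_G_digraph level_card_G_digraph\<close>)
  have D_le: "digraph_spectral_radius D \<le> t - 1"
    if D: "D \<in> digraphs_of_l_connectivity l n \<kappa>" for D :: "'a pair_pre_digraph"
  proof -
    have "1 \<le> l" using assms by simp
    from l_connectivity_layering[OF D this assms(3)] obtain f where f:
      "f ` pverts D \<subseteq> {..l}" "{1..l} \<subseteq> f ` pverts D"
      "parcs D \<subseteq> layered_arcs (pverts D) f" "level_card (pverts D) f 0 = \<kappa>" .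
    have "pair_digraph D" "card (pverts D) = n"
      using D by (auto simp: digraphs_of_l_connectivity_def)
    hence V: "finite (pverts D)" "card (pverts D) = n"
      by (simp_all add: pair_digraph_def pair_fin_digraph.pair_finite_verts)
    let ?c = "level_card (pverts D) f"
    have c: "?c j \<ge> 1" if "j \<in> {1..l}" for j
    proof -
      have "{v \<in> pverts D. f v = j} \<noteq> {}" using f(2) that by blast
      thus ?thesis using V(1) by (simp add: Suc_le_eq card_gt_0_iff)
    qed
    have "n = (\<Sum>j\<in>{..l}. ?c j)"
      using sum.group[OF V(1) _ f(1), of "\<lambda>_. 1::nat"] V(2) by simp
    also have "{..l} = insert 0 {1..l}" by auto
    finally have sum_c: "(\<Sum>j\<in>{1..l}. ?c j) = N + (l - 1)"
      using f(4) N(2) by simp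
    \<comment> \<open>The other \<open>l - 1\<close> layers are nonempty, which leaves at most
      \<open>N\<close> vertices for layer \<open>j\<close>; hence \<open>t > N\<close> exceeds every
      layer size.\<close>
    have c_le: "?c j \<le> N" if "j \<in> {1..l}" for j
    proof -
      have "l - 1 \<le> (\<Sum>i\<in>{1..l} - {j}. ?c i)"
        using sum_mono[of "{1..l} - {j}" "\<lambda>_. 1" ?c] c that by simp
      thus ?thesis using sum.remove[of "{1..l}" j ?c] sum_c that by simp
    qed
    \<comment> \<open>Here the sizes of \<open>D\<close> meet the extremal ones: both sum to
      \<open>N + (l - 1)\<close>.\<close>
    have "(t - real N) * (t - 1) ^ (card {1..l} - 1) \<le> (\<Prod>j\<in>{1..l}. t - real (?c j))"
    proof (rule prod_shifted_ge)
      show "(\<Sum>j\<in>{1..l}. real (?c j)) = real N + real (card {1..l} - 1)"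
        using sum_c by (simp flip: of_nat_sum)
    qed (use assms c t(1) t1 in force)+
    hence "t * ((t - real N) * (t - 1) ^ (l - 1)) \<le> t * (\<Prod>j\<in>{1..l}. t - real (?c j))"
      using t1 by simp
    hence "real (?c 0) * t ^ l \<le> t * (\<Prod>j\<in>{1..l}. t - real (?c j))"
      using t(2) f(4) by simp
    moreover have "real (?c j) < t" if "j \<in> {1..l}" for j
      using c_le[OF that] t(1) by simp
    moreover have "real (?c 0) > 0" using f(4) assms by simp
    ultimately show ?thesis
      using t1 by (intro layered_digraph_spectral_radius_le[OF V(1) f(1,3) refl]) auto
  qed
  have "G_digraph \<kappa> l ns \<in> digraphs_of_l_connectivity l n \<kappa>"
    using assms ns(1) sum_ns N(2) by (intro G_digraph_in_digraphs_of_l_connectivity) auto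
  thus ?thesis using G_ge D_le by force
qed

end
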